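(* Let $C_0$ be an $\mathcal{ALC}$ concept, $\mathcal{O}$ an $\mathcal{ALC}$ ontology, and let $(\mathscr{C}_c\langle C_0,\mathcal{O}\rangle, \mathscr{C}_r\langle C_0,\mathcal{O}\rangle)$ be an ontology category for $\langle C_0,\mathcal{O}\rangle$ (as defined in the context). If $X$ and $Y$ are $\mathcal{ALC}$ concepts that are objects of $\mathscr{C}_c\langle C_0,\mathcal{O}\rangle$ and $X\longrightarrow Y$ is an arrow of $\mathscr{C}_c\langle C_0,\mathcal{O}\rangle$, then $\mathcal{O}\models X\sqsubseteq Y$ under the usual set-theoretical semantics.
   Context: Syntax: fix nonempty sets $\mathbf{C}$ of concept names and $\mathbf{R}$ of role names. $\mathcal{ALC}$ concepts are built from concept names, $\top$, $\bot$ by $C\sqcap D$, $C\sqcup D$, $\neg C$, $\exists R.C$, $\forall R.C$ ($R\in\mathbf{R}$). An ontology $\mathcal{O}$ is a finite set of axioms (GCIs) $E\sqsubseteq F$. Set semantics: an interpretation $\mathcal{I}=(\Delta^\mathcal{I},\cdot^\mathcal{I})$ with $\Delta^\mathcal{I}\neq\emptyset$, concept names mapped to subsets, roles to binary relations, extended as usual ($\top^\mathcal{I}=\Delta^\mathcal{I}$, $\bot^\mathcal{I}=\emptyset$, $\sqcap,\sqcup,\neg$ as intersection, union, complement, $(\exists R.C)^\mathcal{I}=\{x\mid\exists y, (x,y)\in R^\mathcal{I}, y\in C^\mathcal{I}\}$, $(\forall R.C)^\mathcal{I}=\{x\mid\forall y, (x,y)\in R^\mathcal{I}\Rightarrow y\in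 C^\mathcal{I}\}$); $\mathcal{I}$ is a model of $\mathcal{O}$ if $E^\mathcal{I}\subseteq F^\mathcal{I}$ for every axiom; $\mathcal{O}\models X\sqsubseteq Y$ if $X^\mathcal{I}\subseteq Y^\mathcal{I}$ in every model. Categorical framework. A "category" here is a collection of objects with arrows $X\longrightarrow Y$, containing an identity arrow $X\longrightarrow X$ for each object and closed under composition (if $X\longrightarrow Y$ and $Y\longrightarrow Z$ then $X\longrightarrow Z$); only existence of arrows matters. $X\leftrightarrows Y$ means arrows in both directions. An ontology category for $\langle C_0,\mathcal{O}\rangle$ is a pair consisting of a concept category $\mathscr{C}_c$ and a role category $\mathscr{C}_r$ such that: (S1) every role name is an object of $\mathscr{C}_r$; there are objects $R_\bot,R_\top$ with $R_\bot\longrightarrow R\longrightarrow R_\top$ for every role object $R$; (S2) every concept name, $\top$, $\bot$ are objects of $\mathscr{C}_c$, with $\bot\longrightarrow C\longrightarrow\top$ for every concept object $C$; (S3) to each role object $R$ are associated concept objects $\mathsf{dom}(R)$, $\mathsf{cod}(R)$, with $\mathsf{dom}(R_\top)=\mathsf{cod}(R_\top)=\top$, $\mathsf{dom}(R_\bot)=\mathsf{cod}(R_\bot)=\bot$; if $R\longrightarrow R'$ then $\mathsf{dom}(R)\longrightarrow\mathsf{dom}(R')$ and $\mathsf{cod}(R)\longrightarrow\mathsf{cod}(R')$; if $\mathsf{dom}(R)\longrightarrow\bot$ or $\mathsf{cod}(R)\longrightarrow\bot$ then $R\longrightarrow R_\bot$; (S4) $C_0$ is an object of $\mathscr{C}_c$,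 and for each axiom $E\sqsubseteq F$ of $\mathcal{O}$, $E,F$ are objects and $E\longrightarrow F$ is an arrow. Moreover, whenever the objects mentioned are present ($X$ ranges over concept objects, $R'$ over role objects): (Disj) $C\longrightarrow C\sqcup D$, $D\longrightarrow C\sqcup D$; if $C\longrightarrow X$ and $D\longrightarrow X$ then $C\sqcup D\longrightarrow X$. (Conj) $C\sqcap D\longrightarrow C$, $C\sqcap D\longrightarrow D$; if $X\longrightarrow C$ and $X\longrightarrow D$ then $X\longrightarrow C\sqcap D$; $C\sqcap(D\sqcup E)\longrightarrow (C\sqcap D)\sqcup(C\sqcap E)$. (Neg) $C\sqcap\neg C\longrightarrow\bot$; $\top\longrightarrow C\sqcup\neg C$; if $C\sqcap X\longrightarrow\bot$ then $X\longrightarrow\neg C$; if $\top\longrightarrow C\sqcup X$ then $\neg C\longrightarrow X$. (Ex) for each object $\exists R.C$ there is a role object $R_{(\exists R.C)}$ with $R_{(\exists R.C)}\longrightarrow R$, $\mathsf{cod}(R_{(\exists R.C)})\longrightarrow C$, $\mathsf{dom}(R_{(\exists R.C)})\leftrightarrows\exists R.C$; and for every $R'$ with $R'\longrightarrow R$ and $\mathsf{cod}(R')\longrightarrow C$, $\mathsf{dom}(R')\longrightarrow\mathsf{dom}(R_{(\exists R.C)})$. (All1) $\forall R.C\leftrightarrows\neg\exists R.\neg C$. (All2) for every $R'$ with $R'\longrightarrow R$ and $\mathsf{dom}(R')\longrightarrow\forall R.C$, $\mathsf{cod}(R')\longrightarrow C$. An ontology category may contain further objects built from the signature, but no arrow independent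 of these requirements: every arrow is an identity, an axiom arrow, an arrow required by the conditions above, or a composite of such arrows. *)

theory Defs
  imports Main
begin

section \<open>ALC: syntax and set-theoretical semantics\<close>

text \<open>The nonempty sets of concept names and of role names are the types \<open>'c\<close> and \<open>'r\<close>.\<close>

datatype ('c, 'r) concept =
    Name 'c
  | Top
  | Bot
  | Conj "('c, 'r) concept" "('c, 'r) concept"
  | Disj "('c, 'r) concept" "('c, 'r) concept"
  | Neg "('c, 'r) concept"
  | Ex 'r "('c, 'r) concept"
  | All 'r "('c, 'r) concept"

text \<open>The axiom \<open>E \<sqsubseteq> F\<close> is the pair \<open>(E, F)\<close>; ontologies are required to be finite below.\<close>

type_synonym ('c, 'r) ontology = "(('c, 'r) concept \<times> ('c, 'r) concept) set"

record ('c, 'r, 'd) interp =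
  Delta :: "'d set"
  CName :: "'c \<Rightarrow> 'd set"
  RName :: "'r \<Rightarrow> ('d \<times> 'd) set"

definition interpretation_wf :: "('c, 'r, 'd) interp \<Rightarrow> bool" where
  "interpretation_wf I \<longleftrightarrow>
     Delta I \<noteq> {} \<and> (\<forall>A. CName I A \<subseteq> Delta I) \<and> (\<forall>R. RName I R \<subseteq> Delta I \<times> Delta I)"

primrec ext :: "('c, 'r, 'd) interp \<Rightarrow> ('c, 'r) concept \<Rightarrow> 'd set" where
  "ext I (Name A) = CName I A"
| "ext I Top = Delta I"
| "ext I Bot = {}"
| "ext I (Conj C D) = ext I C \<inter> ext I D"
| "ext I (Disj C D) = ext I C \<union> ext I D"
| "ext I (Neg C) = Delta I - ext I C"
| "ext I (Ex R C) = {x \<in> Delta I. \<exists>y. (x, y) \<in> RName I R \<and> y \<in> ext I C}"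
| "ext I (All R C) = {x \<in> Delta I. \<forall>y. (x, y) \<in> RName I R \<longrightarrow> y \<in> ext I C}"

definition is_model :: "('c, 'r, 'd) interp \<Rightarrow> ('c, 'r) ontology \<Rightarrow> bool" where
  "is_model I \<O> \<longleftrightarrow> interpretation_wf I \<and> (\<forall>(E, F) \<in> \<O>. ext I E \<subseteq> ext I F)"

text \<open>The type \<open>'d\<close> supplies the elements of domains. HOL cannot quantify over types inside a
  formula, so it is a parameter; a theorem whose \<open>'d\<close> is a type variable speaks about
  interpretations with domains of any type.\<close>

definition entails ::
  "'d itself \<Rightarrow> ('c, 'r) ontology \<Rightarrow> ('c, 'r) concept \<Rightarrow> ('c, 'r) concept \<Rightarrow> bool" where
  "entails _ \<O> X Y \<longleftrightarrow> (\<forall>I :: ('c, 'r, 'd) interp. is_model I \<O> \<longrightarrow> ext I X \<subseteq> ext I Y)"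


section \<open>Objects built from the signature\<close>

text \<open>Concept objects are generated by the ALC constructors together with \<open>dom(R)\<close> and \<open>cod(R)\<close>,
  role objects by the role names, \<open>R\<^sub>\<top>\<close>, \<open>R\<^sub>\<bottom>\<close> and the roles \<open>R\<^bsub>(\<exists>R.C)\<^esub>\<close>. As \<open>dom\<close> and \<open>cod\<close> of
  \<open>R\<^sub>\<top>\<close> and \<open>R\<^sub>\<bottom>\<close> have to equal \<open>\<top>\<close> and \<open>\<bottom>\<close>, only the other role objects (\<open>prole\<close>)
  get fresh objects \<open>ODom\<close> and \<open>OCod\<close>. Objects have to be freely generated: if, say,
  \<open>R\<^bsub>(\<exists>R.C)\<^esub>\<close> were allowed to coincide with a role name, the conditions imposed on it
  would be additional axioms on that name.\<close>

datatype ('c, 'r) cobj =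
    OName 'c
  | OTop
  | OBot
  | OConj "('c, 'r) cobj" "('c, 'r) cobj"
  | ODisj "('c, 'r) cobj" "('c, 'r) cobj"
  | ONeg "('c, 'r) cobj"
  | OEx "('c, 'r) robj" "('c, 'r) cobj"
  | OAll "('c, 'r) robj" "('c, 'r) cobj"
  | ODom "('c, 'r) prole"
  | OCod "('c, 'r) prole"
and ('c, 'r) robj =
    RTop
  | RBot
  | Proper "('c, 'r) prole"
and ('c, 'r) prole =
    PName 'r
  | PEx "('c, 'r) robj" "('c, 'r) cobj"

abbreviation role_name :: "'r \<Rightarrow> ('c, 'r) robj" where
  "role_name R \<equiv> Proper (PName R)"

text \<open>The role object \<open>R\<^bsub>(\<exists>R.C)\<^esub>\<close>.\<close>

abbreviation role_ex :: "('c, 'r) robj \<Rightarrow> ('c, 'r) cobj \<Rightarrow> ('c, 'r) robj" where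
  "role_ex R C \<equiv> Proper (PEx R C)"

fun rdom :: "('c, 'r) robj \<Rightarrow> ('c, 'r) cobj" where
  "rdom RTop = OTop"
| "rdom RBot = OBot"
| "rdom (Proper P) = ODom P"

fun rcod :: "('c, 'r) robj \<Rightarrow> ('c, 'r) cobj" where
  "rcod RTop = OTop"
| "rcod RBot = OBot"
| "rcod (Proper P) = OCod P"

primrec obj_of :: "('c, 'r) concept \<Rightarrow> ('c, 'r) cobj" where
  "obj_of (Name A) = OName A"
| "obj_of Top = OTop"
| "obj_of Bot = OBot"
| "obj_of (Conj C D) = OConj (obj_of C) (obj_of D)"
| "obj_of (Disj C D) = ODisj (obj_of C) (obj_of D)"
| "obj_of (Neg C) = ONeg (obj_of C)"
| "obj_of (Ex R C) = OEx (role_name R) (obj_of C)"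
| "obj_of (All R C) = OAll (role_name R) (obj_of C)"


section \<open>Ontology categories\<close>

record 'o category =
  Obj :: "'o set"
  Arr :: "'o \<Rightarrow> 'o \<Rightarrow> bool"

definition is_category :: "'o category \<Rightarrow> bool" where
  "is_category K \<longleftrightarrow>
     (\<forall>X Y. Arr K X Y \<longrightarrow> X \<in> Obj K \<and> Y \<in> Obj K) \<and>
     (\<forall>X \<in> Obj K. Arr K X X) \<and>
     (\<forall>X Y Z. Arr K X Y \<longrightarrow> Arr K Y Z \<longrightarrow> Arr K X Z)"

text \<open>The arrows required over given sets \<open>Oc\<close> and \<open>Or\<close> of concept and role objects: an
  introduction rule for each requirement on arrows. Membership premises say that the objects
  mentioned are present; they are omitted for objects that are always present in an ontology
  category and for those at the end of an arrow in a premise.\<close>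

inductive carr :: "('c, 'r) ontology \<Rightarrow> ('c, 'r) cobj set \<Rightarrow> ('c, 'r) robj set \<Rightarrow>
    ('c, 'r) cobj \<Rightarrow> ('c, 'r) cobj \<Rightarrow> bool"
  and rarr :: "('c, 'r) ontology \<Rightarrow> ('c, 'r) cobj set \<Rightarrow> ('c, 'r) robj set \<Rightarrow>
    ('c, 'r) robj \<Rightarrow> ('c, 'r) robj \<Rightarrow> bool"
  for \<O> :: "('c, 'r) ontology" and Oc :: "('c, 'r) cobj set" and Or :: "('c, 'r) robj set"
where
  c_id: "X \<in> Oc \<Longrightarrow> carr \<O> Oc Or X X"
| c_comp: "carr \<O> Oc Or X Y \<Longrightarrow> carr \<O> Oc Or Y Z \<Longrightarrow> carr \<O> Oc Or X Z"
| r_id: "R \<in> Or \<Longrightarrow> rarr \<O> Oc Or R R"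
| r_comp: "rarr \<O> Oc Or R S \<Longrightarrow> rarr \<O> Oc Or S T \<Longrightarrow> rarr \<O> Oc Or R T"

| r_bot: "R \<in> Or \<Longrightarrow> rarr \<O> Oc Or RBot R"
| r_top: "R \<in> Or \<Longrightarrow> rarr \<O> Oc Or R RTop"
| c_bot: "C \<in> Oc \<Longrightarrow> carr \<O> Oc Or OBot C"
| c_top: "C \<in> Oc \<Longrightarrow> carr \<O> Oc Or C OTop"

| dom_mono: "rarr \<O> Oc Or R R' \<Longrightarrow> carr \<O> Oc Or (rdom R) (rdom R')"
| cod_mono: "rarr \<O> Oc Or R R' \<Longrightarrow> carr \<O> Oc Or (rcod R) (rcod R')"
| dom_bot: "R \<in> Or \<Longrightarrow> carr \<O> Oc Or (rdom R) OBot \<Longrightarrow> rarr \<O> Oc Or R RBot"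
| cod_bot: "R \<in> Or \<Longrightarrow> carr \<O> Oc Or (rcod R) OBot \<Longrightarrow> rarr \<O> Oc Or R RBot"

| axiom_arrow: "(E, F) \<in> \<O> \<Longrightarrow> carr \<O> Oc Or (obj_of E) (obj_of F)"

| disj_1: "ODisj C D \<in> Oc \<Longrightarrow> C \<in> Oc \<Longrightarrow> carr \<O> Oc Or C (ODisj C D)"
| disj_2: "ODisj C D \<in> Oc \<Longrightarrow> D \<in> Oc \<Longrightarrow> carr \<O> Oc Or D (ODisj C D)"
| disj_least: "ODisj C D \<in> Oc \<Longrightarrow> carr \<O> Oc Or C X \<Longrightarrow> carr \<O> Oc Or D X \<Longrightarrow>
    carr \<O> Oc Or (ODisj C D) X"

| conj_1: "OConj C D \<in> Oc \<Longrightarrow> C \<in> Oc \<Longrightarrow> carr \<O> Oc Or (OConj C D) C"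
| conj_2: "OConj C D \<in> Oc \<Longrightarrow> D \<in> Oc \<Longrightarrow> carr \<O> Oc Or (OConj C D) D"
| conj_greatest: "OConj C D \<in> Oc \<Longrightarrow> carr \<O> Oc Or X C \<Longrightarrow> carr \<O> Oc Or X D \<Longrightarrow>
    carr \<O> Oc Or X (OConj C D)"
| distrib: "OConj C (ODisj D E) \<in> Oc \<Longrightarrow> ODisj (OConj C D) (OConj C E) \<in> Oc \<Longrightarrow>
    carr \<O> Oc Or (OConj C (ODisj D E)) (ODisj (OConj C D) (OConj C E))"

| neg_conj: "OConj C (ONeg C) \<in> Oc \<Longrightarrow> carr \<O> Oc Or (OConj C (ONeg C)) OBot"
| neg_disj: "ODisj C (ONeg C) \<in> Oc \<Longrightarrow> carr \<O> Oc Or OTop (ODisj C (ONeg C))"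
| neg_greatest: "ONeg C \<in> Oc \<Longrightarrow> X \<in> Oc \<Longrightarrow> carr \<O> Oc Or (OConj C X) OBot \<Longrightarrow>
    carr \<O> Oc Or X (ONeg C)"
| neg_least: "ONeg C \<in> Oc \<Longrightarrow> X \<in> Oc \<Longrightarrow> carr \<O> Oc Or OTop (ODisj C X) \<Longrightarrow>
    carr \<O> Oc Or (ONeg C) X"

| ex_role: "OEx R C \<in> Oc \<Longrightarrow> R \<in> Or \<Longrightarrow> rarr \<O> Oc Or (role_ex R C) R"
| ex_cod: "OEx R C \<in> Oc \<Longrightarrow> C \<in> Oc \<Longrightarrow> carr \<O> Oc Or (rcod (role_ex R C)) C"
| ex_dom_1: "OEx R C \<in> Oc \<Longrightarrow> carr \<O> Oc Or (rdom (role_ex R C)) (OEx R C)"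
| ex_dom_2: "OEx R C \<in> Oc \<Longrightarrow> carr \<O> Oc Or (OEx R C) (rdom (role_ex R C))"
| ex_greatest: "OEx R C \<in> Oc \<Longrightarrow> rarr \<O> Oc Or R' R \<Longrightarrow> carr \<O> Oc Or (rcod R') C \<Longrightarrow>
    carr \<O> Oc Or (rdom R') (rdom (role_ex R C))"

| all_neg_1: "OAll R C \<in> Oc \<Longrightarrow> ONeg (OEx R (ONeg C)) \<in> Oc \<Longrightarrow>
    carr \<O> Oc Or (OAll R C) (ONeg (OEx R (ONeg C)))"
| all_neg_2: "OAll R C \<in> Oc \<Longrightarrow> ONeg (OEx R (ONeg C)) \<in> Oc \<Longrightarrow>
    carr \<O> Oc Or (ONeg (OEx R (ONeg C))) (OAll R C)"
| all_cod: "C \<in> Oc \<Longrightarrow> rarr \<O> Oc Or R' R \<Longrightarrow> carr \<O> Oc Or (rdom R') (OAll R C) \<Longrightarrow>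
    carr \<O> Oc Or (rcod R') C"

text \<open>The last two assumptions say both that all required arrows are there and that there are
  no others.\<close>

locale ontology_category =
  fixes C0 :: "('c, 'r) concept" and \<O> :: "('c, 'r) ontology"
    and Cc :: "('c, 'r) cobj category" and Cr :: "('c, 'r) robj category"
  assumes finite_ontology: "finite \<O>"
    and category_c: "is_category Cc"
    and category_r: "is_category Cr"
    and role_name_obj: "role_name R \<in> Obj Cr"
    and role_bot_obj: "RBot \<in> Obj Cr"
    and role_top_obj: "RTop \<in> Obj Cr"
    and concept_name_obj: "OName A \<in> Obj Cc"
    and top_obj: "OTop \<in> Obj Cc"
    and bot_obj: "OBot \<in> Obj Cc"
    and dom_obj: "R' \<in> Obj Cr \<Longrightarrow> rdom R' \<in> Obj Cc"
    and cod_obj: "R' \<in> Obj Cr \<Longrightarrow> rcod R' \<in> Obj Cc"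
    and C0_obj: "obj_of C0 \<in> Obj Cc"
    and axiom_obj: "(E, F) \<in> \<O> \<Longrightarrow> obj_of E \<in> Obj Cc \<and> obj_of F \<in> Obj Cc"
    and role_ex_obj: "OEx R' C \<in> Obj Cc \<Longrightarrow> role_ex R' C \<in> Obj Cr"
    and arrows_c: "Arr Cc X Y \<longleftrightarrow> carr \<O> (Obj Cc) (Obj Cr) X Y"
    and arrows_r: "Arr Cr R' S' \<longleftrightarrow> rarr \<O> (Obj Cc) (Obj Cr) R' S'"

end

theory Submission imports Defs begin

text \<open>Every set model of the ontology interprets all objects, not only the ALC concepts:
  \<open>R\<^bsub>(\<exists>R.C)\<^esub>\<close> is the relation \<open>R\<close> with its range restricted to \<open>C\<close>, and \<open>dom\<close>, \<open>cod\<close> are domain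
  and range. Under this interpretation each requirement on arrows preserves inclusions, so every
  arrow of the generated category is an inclusion in every model.\<close>

primrec cobj_ext :: "('c, 'r, 'd) interp \<Rightarrow> ('c, 'r) cobj \<Rightarrow> 'd set"
  and robj_ext :: "('c, 'r, 'd) interp \<Rightarrow> ('c, 'r) robj \<Rightarrow> ('d \<times> 'd) set"
  and prole_ext :: "('c, 'r, 'd) interp \<Rightarrow> ('c, 'r) prole \<Rightarrow> ('d \<times> 'd) set"
where
  "cobj_ext I (OName A) = CName I A"
| "cobj_ext I OTop = Delta I"
| "cobj_ext I OBot = {}"
| "cobj_ext I (OConj C D) = cobj_ext I C \<inter> cobj_ext I D"
| "cobj_ext I (ODisj C D) = cobj_ext I C \<union> cobj_ext I D"
| "cobj_ext I (ONeg C) = Delta I - cobj_ext I C"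
| "cobj_ext I (OEx R C) = {x \<in> Delta I. \<exists>y. (x, y) \<in> robj_ext I R \<and> y \<in> cobj_ext I C}"
| "cobj_ext I (OAll R C) = {x \<in> Delta I. \<forall>y. (x, y) \<in> robj_ext I R \<longrightarrow> y \<in> cobj_ext I C}"
| "cobj_ext I (ODom P) = Domain (prole_ext I P)"
| "cobj_ext I (OCod P) = Range (prole_ext I P)"
| "robj_ext I RTop = Delta I \<times> Delta I"
| "robj_ext I RBot = {}"
| "robj_ext I (Proper P) = prole_ext I P"
| "prole_ext I (PName R) = RName I R"
| "prole_ext I (PEx R C) = {(x, y) \<in> robj_ext I R. y \<in> cobj_ext I C}"

text \<open>Ties the semantics of objects to that of ALC, which is how axiom arrows hold in a model
  and how the final inclusion is read back.\<close>

lemma cobj_ext_obj_of [simp]: "cobj_ext I (obj_of C) = ext I C"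
  by (induction C) auto

text \<open>Needed wherever an arrow ends in an object whose meaning is cut off by
  \<open>Delta I\<close>, such as \<open>OTop\<close>, \<open>RTop\<close> or a complement.\<close>

lemma ext_within_Delta:
  assumes "interpretation_wf I"
  shows "cobj_ext I C \<subseteq> Delta I"
    and "robj_ext I R \<subseteq> Delta I \<times> Delta I"
    and "prole_ext I P \<subseteq> Delta I \<times> Delta I"
  by (induction C and R and P) (use assms in \<open>auto simp: interpretation_wf_def\<close>)

text \<open>Since \<open>rdom\<close> returns \<open>OTop\<close> and \<open>OBot\<close> on the
  extreme roles, these are checked separately: the full square has domain \<open>Delta I\<close>,
  the empty relation has empty domain.\<close>

lemma cobj_ext_rdom:
  assumes "interpretation_wf I"
  shows "cobj_ext I (rdom R) = Domain (robj_ext I R)"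
  using assms by (cases R) (auto simp: interpretation_wf_def)

lemma cobj_ext_rcod:
  assumes "interpretation_wf I"
  shows "cobj_ext I (rcod R) = Range (robj_ext I R)"
  using assms by (cases R) (auto simp: interpretation_wf_def)

text \<open>Concept and role arrows feed each other through \<open>rdom\<close> and
  \<open>rcod\<close>, hence one simultaneous induction.\<close>

lemma arrows_sound:
  assumes "is_model I \<O>"
  shows "carr \<O> Oc Or X Y \<Longrightarrow> cobj_ext I X \<subseteq> cobj_ext I Y"
    and "rarr \<O> Oc Or R S \<Longrightarrow> robj_ext I R \<subseteq> robj_ext I S"
proof (induction rule: carr_rarr.inducts)
  have wf: "interpretation_wf I"
    using assms by (simp add: is_model_def)
  note within = ext_within_Delta[OF wf] and dom_cod = cobj_ext_rdom[OF wf] cobj_ext_rcod[OF wf]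
  {
    case (axiom_arrow E F)
    then show ?case
      using assms by (auto simp: is_model_def)
  next
    case (neg_greatest C X)
    then show ?case
      using within(1)[of X] by auto
  next
    case (all_neg_2 R C)
    then show ?case
      \<comment> \<open>Successors lie in \<open>Delta I\<close>, so a successor outside the
        complement of \<open>C\<close> is in \<open>C\<close>.\<close>
      using within(2)[of R] by auto
  next
    case (ex_dom_1 R C)
    then show ?case
      using within(2)[of R] by auto
  next
    case (all_cod C R' R)
    then show ?case
      \<comment> \<open>A pair of \<open>R'\<close> starts in \<open>OAll R C\<close> and is also a
        pair of \<open>R\<close>, so it ends in \<open>C\<close>.\<close>
      by (fastforce simp: dom_cod)
  next
    case (r_top R)
    then show ?case
      using within(2)[of R] by simp
  next
    case (c_top C)
    then show ?case
      using within(1)[of C] by simp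
  }
\<comment> \<open>In \<open>dom_bot\<close> and \<open>cod_bot\<close> an empty domain or range
  forces an empty relation; in \<open>ex_greatest\<close> every pair of \<open>R'\<close> is a pair
  of \<open>role_ex R C\<close>.\<close>
qed (use assms in \<open>auto simp: is_model_def cobj_ext_rdom cobj_ext_rcod; blast\<close>)+

theorem theorem1:
  fixes C0 X Y :: "('c, 'r) concept"
    and \<O> :: "('c, 'r) ontology"
    and Cc :: "('c, 'r) cobj category"
    and Cr :: "('c, 'r) robj category"
  assumes "ontology_category C0 \<O> Cc Cr"
    and "obj_of X \<in> Obj Cc" and "obj_of Y \<in> Obj Cc"
    and "Arr Cc (obj_of X) (obj_of Y)"
  shows "entails TYPE('d) \<O> X Y"
proof -
  have "carr \<O> (Obj Cc) (Obj Cr) (obj_of X) (obj_of Y)"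
    using assms ontology_category.arrows_c by blast
  then show ?thesis
    using arrows_sound(1) by (fastforce simp: entails_def)
qed

end
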